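(* Let $\lambda,\mu\in\mathbb{C}^*$, $\alpha,\beta\in\mathbb{C}$, $h(t),g(t)\in\mathbb{C}[t]$. Then: (i) $\Pi\big(\Omega_{\mathfrak{S}^{\frac12}}(\lambda,\alpha,h)\big)\not\cong\Omega_{\mathfrak{S}^{\frac12}}(\lambda',\alpha',h')$ for any $\lambda'\in\mathbb{C}^*$, $\alpha'\in\mathbb{C}$, $h'(t)\in\mathbb{C}[t]$; (ii) $\Omega_{\mathfrak{S}^{\frac12}}(\lambda,\alpha,h)\cong\Omega_{\mathfrak{S}^{\frac12}}(\mu,\beta,g)$ if and only if $\lambda=\mu$, $\alpha=\beta$ and $h=g$.
   Context: All vector spaces are over $\mathbb{C}$. The Neveu-Schwarz type super-BMS$_3$ algebra $\mathfrak{S}^{\frac12}$ is the Lie superalgebra with basis $\{L_m,W_m,G_r,C_1,C_2\mid m\in\mathbb{Z},r\in\frac12+\mathbb{Z}\}$, where $L_m,W_m,C_1,C_2$ are even, the $G_r$ are odd, $C_1,C_2$ are central, and the non-trivial brackets are $$[L_m,L_n]=(n-m)L_{m+n}+\tfrac{n^3-n}{12}\delta_{m+n,0}C_1,\quad [L_m,W_n]=(n-m)W_{m+n}+\tfrac{n^3-n}{12}\delta_{m+n,0}C_2,$$ $$[L_m,G_r]=(r-\tfrac m2)G_{m+r},\quad [G_r,G_s]=2W_{r+s}+\tfrac13(r^2-\tfrac14)\delta_{r+s,0}C_2.$$ Modules over a Lie superalgebra are $\mathbb{Z}_2$-graded, with $x(yv)-(-1)^{|x||y|}y(xv)=[x,y]v$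 for homogeneous $x,y$. $\Pi$ is the parity-change functor, which interchanges the even and odd parts of a module. $\cong$ denotes isomorphism of modules by a parity-preserving (even) map. For a polynomial $h$, $\alpha\in\mathbb{C}$ and $m\in\mathbb{Z}$, $h_m(t)=m\,h(t)-m(m-1)\alpha\,\frac{h(t)-h(\alpha)}{t-\alpha}\in\mathbb{C}[t]$. For $\lambda\in\mathbb{C}^*$, $\alpha\in\mathbb{C}$, $h\in\mathbb{C}[t]$, $\Omega_{\mathfrak{S}^{\frac12}}(\lambda,\alpha,h)$ is the $\mathfrak{S}^{\frac12}$-module with underlying space $M=\mathbb{C}[t,s]\oplus\mathbb{C}[y,x]$, $M_{\bar 0}=\mathbb{C}[t,s]$, $M_{\bar 1}=\mathbb{C}[y,x]$, and action (for $m\in\mathbb{Z}$, $r\in\frac12+\mathbb{Z}$, $f(t,s)\in\mathbb{C}[t,s]$, $k(y,x)\in\mathbb{C}[y,x]$) $$L_mf(t,s)=\lambda^m(s+h_m(t))f(t,s-m)-m\lambda^m(t-m\alpha)\tfrac{\partial}{\partial t}(f(t,s-m)),$$ $$L_mk(y,x)=\lambda^m(x-\tfrac m2+h_m(y))k(y,x-m)-m\lambda^m(y-m\alpha)\tfrac{\partial}{\partial y}k(y,x-m),$$ $$W_mf(t,s)=\lambda^m(t-m\alpha)f(t,s-m),\quad W_mk(y,x)=\lambda^m(y-m\alpha)k(y,x-m),$$ $$G_rf(t,s)=\lambda^{r-\frac12}f(y,x-r)\in\mathbb{C}[y,x],\quad G_rk(y,x)=\lambda^{r+\frac12}(t-2r\alpha)k(t,s-r)\in\mathbb{C}[t,s],$$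 with $C_1,C_2$ acting as $0$. *)

theory Defs
  imports
    Complex_Main
    "HOL-Library.Poly_Mapping"
    "HOL-Library.Product_Plus"
    "HOL-Computational_Algebra.Polynomial"
begin

section \<open>The Neveu-Schwarz type super-BMS algebra\<close>

text \<open>The odd basis vectors are indexed by integers: \<open>G k\<close> stands for \<open>G\<^sub>r\<close> with
  \<open>r = k + 1/2 = half k\<close>.\<close>

datatype sbms_gen = L int | W int | G int | C1 | C2

definition half :: "int \<Rightarrow> complex" where
  "half k = of_int k + 1 / 2"

text \<open>Parities are Booleans: \<open>False\<close> is even, \<open>True\<close> is odd, and addition in \<open>\<int>/2\<close> is \<open>\<noteq>\<close>.\<close>

fun gen_parity :: "sbms_gen \<Rightarrow> bool" where
  "gen_parity (G k) = True"
| "gen_parity _ = False"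

definition koszul :: "bool \<Rightarrow> bool \<Rightarrow> complex" where
  "koszul p q = (if p \<and> q then -1 else 1)"

type_synonym sbms = "sbms_gen \<Rightarrow>\<^sub>0 complex"

definition sbms_scale :: "complex \<Rightarrow> sbms \<Rightarrow> sbms" where
  "sbms_scale c x = Poly_Mapping.map ((*) c) x"

definition sbms_part :: "bool \<Rightarrow> sbms set" where
  "sbms_part p = {x. \<forall>g \<in> Poly_Mapping.keys x. gen_parity g = p}"

definition lin_ext :: "(complex \<Rightarrow> 'v \<Rightarrow> 'v) \<Rightarrow> (sbms_gen \<Rightarrow> 'v) \<Rightarrow> sbms \<Rightarrow> 'v::comm_monoid_add" where
  "lin_ext scl F x = (\<Sum>g \<in> Poly_Mapping.keys x. scl (Poly_Mapping.lookup x g) (F g))"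

text \<open>In the clause for \<open>[G,G]\<close>, \<open>r + s = k + l + 1\<close> for \<open>r = half k\<close> and \<open>s = half l\<close>. The clauses for
  \<open>[W,L]\<close> and \<open>[G,L]\<close> are those forced by super skew symmetry.\<close>

fun gen_bracket :: "sbms_gen \<Rightarrow> sbms_gen \<Rightarrow> sbms" where
  "gen_bracket (L m) (L n) =
     Poly_Mapping.single (L (m + n)) (of_int (n - m)) +
     (if m + n = 0 then Poly_Mapping.single C1 (of_int (n ^ 3 - n) / 12) else 0)"
| "gen_bracket (L m) (W n) =
     Poly_Mapping.single (W (m + n)) (of_int (n - m)) +
     (if m + n = 0 then Poly_Mapping.single C2 (of_int (n ^ 3 - n) / 12) else 0)"
| "gen_bracket (W n) (L m) =
     - (Poly_Mapping.single (W (m + n)) (of_int (n - m)) +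
     (if m + n = 0 then Poly_Mapping.single C2 (of_int (n ^ 3 - n) / 12) else 0))"
| "gen_bracket (L m) (G k) = Poly_Mapping.single (G (m + k)) (half k - of_int m / 2)"
| "gen_bracket (G k) (L m) = - Poly_Mapping.single (G (m + k)) (half k - of_int m / 2)"
| "gen_bracket (G k) (G l) =
     Poly_Mapping.single (W (k + l + 1)) 2 +
     (if k + l + 1 = 0 then Poly_Mapping.single C2 ((half k ^ 2 - 1 / 4) / 3) else 0)"
| "gen_bracket _ _ = 0"

definition sbms_bracket :: "sbms \<Rightarrow> sbms \<Rightarrow> sbms" where
  "sbms_bracket x y =
     lin_ext sbms_scale (\<lambda>i. lin_ext sbms_scale (\<lambda>j. gen_bracket i j) y) x"


section \<open>Modules, parity change, and even isomorphisms\<close>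

text \<open>The underlying vector space is a whole type. \<open>part M False\<close> and \<open>part M True\<close> are the even and
  the odd part.\<close>

record 'v supermodule =
  scale :: "complex \<Rightarrow> 'v \<Rightarrow> 'v"
  part :: "bool \<Rightarrow> 'v set"
  act :: "sbms \<Rightarrow> 'v \<Rightarrow> 'v"

definition is_supermodule :: "'v::ab_group_add supermodule \<Rightarrow> bool" where
  "is_supermodule M \<longleftrightarrow>
     vector_space (scale M) \<and>
     (\<forall>p. module.subspace (scale M) (part M p)) \<and>
     part M False \<inter> part M True = {0} \<and>
     (\<forall>v. \<exists>a \<in> part M False. \<exists>b \<in> part M True. v = a + b) \<and>
     (\<forall>x. Vector_Spaces.linear (scale M) (scale M) (act M x)) \<and>
     (\<forall>v. Vector_Spaces.linear sbms_scale (scale M) (\<lambda>x. act M x v)) \<and>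
     (\<forall>p q. \<forall>x \<in> sbms_part p. \<forall>v \<in> part M q. act M x v \<in> part M (p \<noteq> q)) \<and>
     (\<forall>p q. \<forall>x \<in> sbms_part p. \<forall>y \<in> sbms_part q. \<forall>v.
        act M x (act M y v) - scale M (koszul p q) (act M y (act M x v)) =
        act M (sbms_bracket x y) v)"

definition Pi_change :: "'v supermodule \<Rightarrow> 'v supermodule" where
  "Pi_change M = M\<lparr>part := (\<lambda>p. part M (\<not> p))\<rparr>"

definition supermodule_iso ::
    "'v::ab_group_add supermodule \<Rightarrow> 'w::ab_group_add supermodule \<Rightarrow> bool" (infix \<open>\<cong>\<^sub>s\<close> 50) where
  "M \<cong>\<^sub>s N \<longleftrightarrow>
     (\<exists>f. Vector_Spaces.linear (scale M) (scale N) f \<and> bij f \<and>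
        (\<forall>p. f ` part M p \<subseteq> part N p) \<and>
        (\<forall>x v. f (act M x v) = act N x (f v)))"


section \<open>The modules \<open>\<Omega>(lam, \<alpha>, h)\<close>\<close>

text \<open>\<open>\<complex>[t,s]\<close> is represented as \<open>\<complex>[t][s]\<close>, that is, by polynomials in \<open>s\<close> with coefficients in
  \<open>\<complex>[t]\<close>. The same type represents \<open>\<complex>[y,x]\<close>, with \<open>y\<close> and \<open>x\<close> in the roles of \<open>t\<close> and \<open>s\<close>, so
  that the substitution \<open>f(t,s) \<mapsto> f(y,x)\<close> is the identity on representations.\<close>

type_synonym poly2 = "complex poly poly"

definition const2 :: "complex \<Rightarrow> poly2" where
  "const2 c = [:[:c:]:]"

definition in_t :: "complex poly \<Rightarrow> poly2" where
  "in_t p = [:p:]"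

definition var_t :: poly2 where
  "var_t = in_t [:0, 1:]"

definition var_s :: poly2 where
  "var_s = [:0, 1:]"

definition scale2 :: "complex \<Rightarrow> poly2 \<Rightarrow> poly2" where
  "scale2 c f = const2 c * f"

text \<open>\<open>shift a f\<close> is \<open>f(t, s - a)\<close>.\<close>

definition shift :: "complex \<Rightarrow> poly2 \<Rightarrow> poly2" where
  "shift a f = pcompose f (var_s - const2 a)"

definition d_t :: "poly2 \<Rightarrow> poly2" where
  "d_t f = map_poly pderiv f"

definition h_seq :: "complex \<Rightarrow> complex poly \<Rightarrow> int \<Rightarrow> complex poly" where
  "h_seq \<alpha> h m =
     smult (of_int m) h -
     smult (of_int (m * (m - 1)) * \<alpha>) ((h - [:poly h \<alpha>:]) div [:- \<alpha>, 1:])"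

text \<open>In the clause for \<open>G j\<close>, with \<open>r = half j\<close>, the exponents \<open>r - 1/2\<close> and \<open>r + 1/2\<close> are \<open>j\<close> and
  \<open>j + 1\<close>. The parameter \<open>lam\<close> is intended to be nonzero.\<close>

fun omega_gen ::
    "complex \<Rightarrow> complex \<Rightarrow> complex poly \<Rightarrow> sbms_gen \<Rightarrow> poly2 \<times> poly2 \<Rightarrow> poly2 \<times> poly2" where
  "omega_gen lam \<alpha> h (L m) (f, k) =
     (scale2 (lam powi m) ((var_s + in_t (h_seq \<alpha> h m)) * shift (of_int m) f) -
      scale2 (of_int m * lam powi m)
        ((var_t - const2 (of_int m * \<alpha>)) * d_t (shift (of_int m) f)),
      scale2 (lam powi m)
        ((var_s - const2 (of_int m / 2) + in_t (h_seq \<alpha> h m)) * shift (of_int m) k) -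
      scale2 (of_int m * lam powi m)
        ((var_t - const2 (of_int m * \<alpha>)) * d_t (shift (of_int m) k)))"
| "omega_gen lam \<alpha> h (W m) (f, k) =
     (scale2 (lam powi m) ((var_t - const2 (of_int m * \<alpha>)) * shift (of_int m) f),
      scale2 (lam powi m) ((var_t - const2 (of_int m * \<alpha>)) * shift (of_int m) k))"
| "omega_gen lam \<alpha> h (G j) (f, k) =
     (scale2 (lam powi (j + 1)) ((var_t - const2 (2 * half j * \<alpha>)) * shift (half j) k),
      scale2 (lam powi j) (shift (half j) f))"
| "omega_gen lam \<alpha> h C1 v = 0"
| "omega_gen lam \<alpha> h C2 v = 0"

definition pair_scale :: "complex \<Rightarrow> poly2 \<times> poly2 \<Rightarrow> poly2 \<times> poly2" where
  "pair_scale c v = (scale2 c (fst v), scale2 c (snd v))"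

definition Omega :: "complex \<Rightarrow> complex \<Rightarrow> complex poly \<Rightarrow> (poly2 \<times> poly2) supermodule" where
  "Omega lam \<alpha> h =
     \<lparr>scale = pair_scale,
      part = (\<lambda>p. if p then {v. fst v = 0} else {v. snd v = 0}),
      act = (\<lambda>x v. lin_ext pair_scale (\<lambda>g. omega_gen lam \<alpha> h g v) x)\<rparr>"


section \<open>Well-definedness: the algebra is a Lie superalgebra, and \<open>\<Omega>\<close> a module over it\<close>

lemma lookup_sbms_scale [simp]: "Poly_Mapping.lookup (sbms_scale c x) g = c * Poly_Mapping.lookup x g"
  unfolding sbms_scale_def by (simp add: Poly_Mapping.map.rep_eq when_def)

lemma vector_space_sbms: "vector_space sbms_scale"
  by unfold_locales (auto intro!: poly_mapping_eqI simp: lookup_add algebra_simps)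

lemma vs_linearI:
  fixes s1 :: "complex \<Rightarrow> 'v::ab_group_add \<Rightarrow> 'v" and s2 :: "complex \<Rightarrow> 'w::ab_group_add \<Rightarrow> 'w"
  assumes "vector_space s1" "vector_space s2"
    and "\<And>x y. f (x + y) = f x + f y" "\<And>c x. f (s1 c x) = s2 c (f x)"
  shows "Vector_Spaces.linear s1 s2 f"
  using assms unfolding Vector_Spaces.linear_iff by blast

lemma lin_ext_superset:
  assumes "vector_space scl" "finite A" "Poly_Mapping.keys x \<subseteq> A"
  shows "lin_ext scl F x = (\<Sum>g \<in> A. scl (Poly_Mapping.lookup x g) (F g))"
proof -
  interpret vector_space scl by fact
  show ?thesis unfolding lin_ext_def
    by (rule sum.mono_neutral_left) (use assms in \<open>auto simp: in_keys_iff\<close>)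
qed

lemma linear_lin_ext:
  fixes scl :: "complex \<Rightarrow> 'v::ab_group_add \<Rightarrow> 'v"
  assumes "vector_space scl"
  shows "Vector_Spaces.linear sbms_scale scl (lin_ext scl F)"
proof -
  interpret S: vector_space sbms_scale by (rule vector_space_sbms)
  interpret V: vector_space scl by fact
  show ?thesis
  proof (rule vs_linearI[OF vector_space_sbms assms])
    fix x y :: sbms
    let ?A = "Poly_Mapping.keys x \<union> Poly_Mapping.keys y"
    have "Poly_Mapping.keys (x + y) \<subseteq> ?A" by (rule keys_add)
    then show "lin_ext scl F (x + y) = lin_ext scl F x + lin_ext scl F y"
      by (simp add: lin_ext_superset[OF assms, of ?A] lookup_add V.scale_left_distrib sum.distrib)
  next
    fix c x
    have "Poly_Mapping.keys (sbms_scale c x) \<subseteq> Poly_Mapping.keys x" by (auto simp: in_keys_iff)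
    then show "lin_ext scl F (sbms_scale c x) = scl c (lin_ext scl F x)"
      by (simp add: lin_ext_superset[OF assms, of "Poly_Mapping.keys x"] V.scale_sum_right)
  qed
qed

lemma lin_ext_single:
  assumes "vector_space scl"
  shows "lin_ext scl F (Poly_Mapping.single g c) = scl c (F g)"
proof -
  interpret V: vector_space scl by fact
  show ?thesis
    by (simp add: lin_ext_superset[OF assms, of "{g}"])
qed

lemma linear_lin_ext_arg:
  fixes scl :: "complex \<Rightarrow> 'v::ab_group_add \<Rightarrow> 'v"
  assumes "vector_space scl" "\<And>g. Vector_Spaces.linear scl scl (A g)"
  shows "Vector_Spaces.linear scl scl (\<lambda>v. lin_ext scl (\<lambda>g. A g v) x)"
proof -
  interpret V: vector_space scl by fact
  interpret P: vector_space_pair scl scl by unfold_locales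
  show ?thesis unfolding lin_ext_def
    by (intro P.linear_compose_sum P.linear_compose_scale_right ballI assms(2))
qed

lemma supermodule_lin_ext:
  fixes scl :: "complex \<Rightarrow> 'v::ab_group_add \<Rightarrow> 'v"
  assumes vs: "vector_space scl"
    and sub: "\<And>p. module.subspace scl (pt p)"
    and int: "pt False \<inter> pt True = {0}"
    and sum: "\<And>v. \<exists>a \<in> pt False. \<exists>b \<in> pt True. v = a + b"
    and lin: "\<And>g. Vector_Spaces.linear scl scl (A g)"
    and par: "\<And>g q v. v \<in> pt q \<Longrightarrow> A g v \<in> pt (gen_parity g \<noteq> q)"
    and rel: "\<And>i j v. A i (A j v) - scl (koszul (gen_parity i) (gen_parity j)) (A j (A i v)) =
                lin_ext scl (\<lambda>g. A g v) (gen_bracket i j)"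
  shows "is_supermodule \<lparr>scale = scl, part = pt, act = (\<lambda>x v. lin_ext scl (\<lambda>g. A g v) x)\<rparr>"
proof -
  interpret V: vector_space scl by fact
  let ?act = "\<lambda>x v. lin_ext scl (\<lambda>g. A g v) x"
  have closed: "?act x v \<in> pt (p \<noteq> q)" if "x \<in> sbms_part p" "v \<in> pt q" for p q x v
    unfolding lin_ext_def
    by (rule V.subspace_sum[OF sub], rule V.subspace_scale[OF sub])
       (use that par in \<open>force simp: sbms_part_def\<close>)
  have A_sum: "A i (\<Sum>j\<in>B. scl (c j) (u j)) = (\<Sum>j\<in>B. scl (c j) (A i (u j)))" for i B c and u :: "sbms_gen \<Rightarrow> 'v"
  proof -
    interpret l: Vector_Spaces.linear scl scl "A i" by (rule lin)
    show ?thesis by (simp add: l.sum l.scale)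
  qed
  have rel': "?act x (?act y v) - scl (koszul p q) (?act y (?act x v)) = ?act (sbms_bracket x y) v"
    if x: "x \<in> sbms_part p" and y: "y \<in> sbms_part q" for x y p q v
  proof -
    interpret e: Vector_Spaces.linear sbms_scale scl "lin_ext scl (\<lambda>g. A g v)"
      by (rule linear_lin_ext[OF vs])
    have 1: "?act x (?act y v) = (\<Sum>i\<in>Poly_Mapping.keys x. \<Sum>j\<in>Poly_Mapping.keys y. scl (Poly_Mapping.lookup x i * Poly_Mapping.lookup y j) (A i (A j v)))"
      by (simp add: lin_ext_def A_sum V.scale_sum_right)
    have "?act y (?act x v) = (\<Sum>j\<in>Poly_Mapping.keys y. \<Sum>i\<in>Poly_Mapping.keys x. scl (Poly_Mapping.lookup x i * Poly_Mapping.lookup y j) (A j (A i v)))"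
      by (simp add: lin_ext_def A_sum V.scale_sum_right mult.commute)
    also have "\<dots> = (\<Sum>i\<in>Poly_Mapping.keys x. \<Sum>j\<in>Poly_Mapping.keys y. scl (Poly_Mapping.lookup x i * Poly_Mapping.lookup y j) (A j (A i v)))"
      by (rule sum.swap)
    finally have 2: "scl (koszul p q) (?act y (?act x v)) =
       (\<Sum>i\<in>Poly_Mapping.keys x. \<Sum>j\<in>Poly_Mapping.keys y. scl (Poly_Mapping.lookup x i * Poly_Mapping.lookup y j) (scl (koszul p q) (A j (A i v))))"
      by (simp add: V.scale_sum_right mult_ac)
    have 3: "?act (sbms_bracket x y) v =
       (\<Sum>i\<in>Poly_Mapping.keys x. \<Sum>j\<in>Poly_Mapping.keys y. scl (Poly_Mapping.lookup x i * Poly_Mapping.lookup y j) (?act (gen_bracket i j) v))"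
      unfolding sbms_bracket_def lin_ext_def[of sbms_scale]
      by (simp add: e.sum e.scale V.scale_sum_right)
    have "koszul p q = koszul (gen_parity i) (gen_parity j)" if "i \<in> Poly_Mapping.keys x" "j \<in> Poly_Mapping.keys y" for i j
      using x y that by (auto simp: sbms_part_def)
    then show ?thesis
      unfolding 1 2 3 sum_subtractf[symmetric] V.scale_right_diff_distrib[symmetric]
      by (intro sum.cong refl) (simp add: rel)
  qed
  show ?thesis
    unfolding is_supermodule_def
    using vs sub int sum closed rel' linear_lin_ext[OF vs] linear_lin_ext_arg[OF vs lin]
    by simp
qed

lemma sbms_bracket_super_skew:
  assumes "x \<in> sbms_part p" "y \<in> sbms_part q"
  shows "sbms_bracket x y = sbms_scale (- koszul p q) (sbms_bracket y x)"
proof -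
  interpret S: vector_space sbms_scale by (rule vector_space_sbms)
  have neg1: "sbms_scale (- 1) z = - z" "sbms_scale 1 z = z" for z
    by (rule poly_mapping_eqI; simp)+
  have LL: "gen_bracket (L m) (L n) = - gen_bracket (L n) (L m)" for m n
  proof (cases "m + n = 0")
    case True
    then have n: "n = - m" by simp
    show ?thesis unfolding n
      by (rule poly_mapping_eqI) (simp add: lookup_add lookup_minus lookup_single when_def field_simps)
  next
    case False
    then show ?thesis
      by (intro poly_mapping_eqI) (simp add: lookup_single when_def add.commute)
  qed
  have GG: "gen_bracket (G m) (G n) = gen_bracket (G n) (G m)" for m n
  proof (cases "m + n + 1 = 0")
    case True
    then have n: "n = - m - 1" by simp
    show ?thesis unfolding n by (simp add: half_def power2_eq_square algebra_simps)
  next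
    case False
    then show ?thesis by (simp add: add.commute)
  qed
  have skew: "gen_bracket i j = sbms_scale (- koszul (gen_parity i) (gen_parity j)) (gen_bracket j i)" for i j
  proof -
    consider m n where "i = L m" "j = L n" | m n where "i = G m" "j = G n"
      | "\<nexists>m n. i = L m \<and> j = L n" "\<nexists>m n. i = G m \<and> j = G n"
      by blast
    then show ?thesis
    proof cases
      case (1 m n)
      show ?thesis unfolding 1 by (subst LL) (simp add: koszul_def neg1 del: gen_bracket.simps)
    next
      case (2 m n)
      show ?thesis unfolding 2 by (subst GG) (simp add: koszul_def neg1 del: gen_bracket.simps)
    next
      case 3
      then show ?thesis by (cases i; cases j; simp add: koszul_def neg1)
    qed
  qed
  have "sbms_bracket x y = (\<Sum>i\<in>Poly_Mapping.keys x. \<Sum>j\<in>Poly_Mapping.keys y. sbms_scale (Poly_Mapping.lookup x i * Poly_Mapping.lookup y j) (gen_bracket i j))"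
    by (simp add: sbms_bracket_def lin_ext_def S.scale_sum_right)
  also have "\<dots> = (\<Sum>i\<in>Poly_Mapping.keys x. \<Sum>j\<in>Poly_Mapping.keys y. sbms_scale (- koszul p q) (sbms_scale (Poly_Mapping.lookup x i * Poly_Mapping.lookup y j) (gen_bracket j i)))"
  proof (intro sum.cong refl)
    fix i j assume "i \<in> Poly_Mapping.keys x" "j \<in> Poly_Mapping.keys y"
    then have "gen_parity i = p" "gen_parity j = q" using assms by (auto simp: sbms_part_def)
    then show "sbms_scale (Poly_Mapping.lookup x i * Poly_Mapping.lookup y j) (gen_bracket i j) =
        sbms_scale (- koszul p q) (sbms_scale (Poly_Mapping.lookup x i * Poly_Mapping.lookup y j) (gen_bracket j i))"
      using skew[of i j] by (simp add: mult_ac)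
  qed
  also have "\<dots> = sbms_scale (- koszul p q) (\<Sum>j\<in>Poly_Mapping.keys y. \<Sum>i\<in>Poly_Mapping.keys x. sbms_scale (Poly_Mapping.lookup x i * Poly_Mapping.lookup y j) (gen_bracket j i))"
    by (subst sum.swap) (simp only: S.scale_sum_right)
  also have "(\<Sum>j\<in>Poly_Mapping.keys y. \<Sum>i\<in>Poly_Mapping.keys x. sbms_scale (Poly_Mapping.lookup x i * Poly_Mapping.lookup y j) (gen_bracket j i)) = sbms_bracket y x"
    by (simp add: sbms_bracket_def lin_ext_def S.scale_sum_right mult.commute)
  finally show ?thesis .
qed

lemma sbms_ext_single:
  assumes "Vector_Spaces.linear sbms_scale scl F" "Vector_Spaces.linear sbms_scale scl F'"
    and "\<And>g. F (Poly_Mapping.single g 1) = F' (Poly_Mapping.single g 1)"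
  shows "F x = F' x"
proof -
  interpret F: Vector_Spaces.linear sbms_scale scl F by fact
  interpret F': Vector_Spaces.linear sbms_scale scl F' by fact
  have x: "x = (\<Sum>g\<in>Poly_Mapping.keys x. sbms_scale (Poly_Mapping.lookup x g) (Poly_Mapping.single g 1))"
    by (rule poly_mapping_eqI)
       (auto simp: lookup_sum lookup_single when_def in_keys_iff if_distrib sum.delta cong: if_cong)
  show ?thesis
    by (subst (1 2) x) (simp only: F.sum F'.sum F.scale F'.scale assms(3))
qed

lemma sbms_scale_single [simp]: "sbms_scale c (Poly_Mapping.single g d) = Poly_Mapping.single g (c * d)"
  by (rule poly_mapping_eqI) (simp add: lookup_single when_def)

lemma subspace_sbms_part: "module.subspace sbms_scale (sbms_part p)"
proof -
  interpret S: vector_space sbms_scale by (rule vector_space_sbms)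
  show ?thesis
  proof (rule S.subspaceI)
    show "0 \<in> sbms_part p" by (simp add: sbms_part_def)
    show "x + y \<in> sbms_part p" if "x \<in> sbms_part p" "y \<in> sbms_part p" for x y
      using that keys_add[of x y] by (auto simp: sbms_part_def)
    show "sbms_scale c x \<in> sbms_part p" if "x \<in> sbms_part p" for c x
      using that by (auto simp: sbms_part_def in_keys_iff)
  qed
qed

lemma gen_bracket_parity: "gen_bracket i j \<in> sbms_part (gen_parity i \<noteq> gen_parity j)"
proof -
  have sg: "Poly_Mapping.single g c \<in> sbms_part p" if "gen_parity g = p" for g c p
    using that by (auto simp: sbms_part_def)
  interpret S: vector_space sbms_scale by (rule vector_space_sbms)
  note S = S.subspace_add[OF subspace_sbms_part] S.subspace_neg[OF subspace_sbms_part]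
     S.subspace_0[OF subspace_sbms_part] S.subspace_diff[OF subspace_sbms_part]
  show ?thesis
    by (cases i; cases j) (auto intro!: S sg)
qed

text \<open>The super Jacobi identity: with its bracket, the algebra is a module over itself.\<close>

lemma sbms_super_jacobi:
  "is_supermodule \<lparr>scale = sbms_scale, part = sbms_part, act = sbms_bracket\<rparr>"
proof -
  interpret S: vector_space sbms_scale by (rule vector_space_sbms)
  interpret P: vector_space_pair sbms_scale sbms_scale by unfold_locales
  let ?A = "\<lambda>i. lin_ext sbms_scale (gen_bracket i)"
  have lin: "Vector_Spaces.linear sbms_scale sbms_scale (lin_ext sbms_scale F)" for F
    by (rule linear_lin_ext[OF vector_space_sbms])
  have ext_add: "lin_ext sbms_scale F (x + y) = lin_ext sbms_scale F x + lin_ext sbms_scale F y"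
    and ext_diff: "lin_ext sbms_scale F (x - y) = lin_ext sbms_scale F x - lin_ext sbms_scale F y"
    and ext_neg: "lin_ext sbms_scale F (- x) = - lin_ext sbms_scale F x"
    and ext_0: "lin_ext sbms_scale F 0 = 0"
    and ext_scale: "lin_ext sbms_scale F (sbms_scale c x) = sbms_scale c (lin_ext sbms_scale F x)"
    for F x y c
    using lin P.linear_add P.linear_diff P.linear_neg P.linear_0 P.linear_scale by blast+
  have ext_if: "lin_ext sbms_scale F (if b then x else 0) = (if b then lin_ext sbms_scale F x else 0)"
    for F b x by (simp add: ext_0)
  have neg1: "sbms_scale (- 1) z = - z" "sbms_scale 1 z = z" for z
    by (rule poly_mapping_eqI; simp)+
  have scale_if: "sbms_scale c (if b then x else 0) = (if b then sbms_scale c x else 0)"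
    for c b x by simp
  note ext = ext_add ext_diff ext_neg ext_0 ext_if lin_ext_single[OF vector_space_sbms] neg1
    S.scale_right_distrib S.scale_right_diff_distrib S.scale_minus_right scale_if koszul_def
  note look = lookup_add lookup_minus lookup_single when_def half_def power2_eq_square power3_eq_cube
  have rel_gen: "?A i (gen_bracket j k) - sbms_scale (koszul (gen_parity i) (gen_parity j)) (?A j (gen_bracket i k)) =
      lin_ext sbms_scale (\<lambda>g. gen_bracket g k) (gen_bracket i j)" (is "?R i j k") for i j k
  proof -
    have LLL: "?R (L a) (L b) (L c)" for a b c
    proof (cases "a + b + c = 0")
      case True
      then have c: "c = - a - b" by simp
      show ?thesis unfolding c
        by (rule poly_mapping_eqI) (simp add: ext look field_simps)
    next
      case False
      then have "a + (b + c) \<noteq> 0" by simp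
      then show ?thesis
        by (intro poly_mapping_eqI) (simp add: ext look algebra_simps)
    qed
    have LLW: "?R (L a) (L b) (W c)" for a b c
    proof (cases "a + b + c = 0")
      case True
      then have c: "c = - a - b" by simp
      show ?thesis unfolding c
        by (rule poly_mapping_eqI) (simp add: ext look field_simps)
    next
      case False
      then have "a + (b + c) \<noteq> 0" by simp
      then show ?thesis
        by (intro poly_mapping_eqI) (simp add: ext look algebra_simps)
    qed
    have LWL: "?R (L a) (W b) (L c)" for a b c
    proof (cases "a + b + c = 0")
      case True
      then have c: "c = - a - b" by simp
      show ?thesis unfolding c
        by (rule poly_mapping_eqI) (simp add: ext look field_simps)
    next
      case False
      then have "a + (b + c) \<noteq> 0" by simp
      then show ?thesis
        by (intro poly_mapping_eqI) (simp add: ext look algebra_simps)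
    qed
    have WLL: "?R (W a) (L b) (L c)" for a b c
    proof (cases "a + b + c = 0")
      case True
      then have c: "c = - a - b" by simp
      show ?thesis unfolding c
        by (rule poly_mapping_eqI) (simp add: ext look field_simps)
    next
      case False
      then have "a + (b + c) \<noteq> 0" by simp
      then show ?thesis
        by (intro poly_mapping_eqI) (simp add: ext look algebra_simps)
    qed
    have LLG: "?R (L a) (L b) (G c)" for a b c
      by (rule poly_mapping_eqI) (simp add: ext look field_simps)
    have LGL: "?R (L a) (G b) (L c)" for a b c
      by (rule poly_mapping_eqI) (simp add: ext look field_simps)
    have GLL: "?R (G a) (L b) (L c)" for a b c
      by (rule poly_mapping_eqI) (simp add: ext look field_simps)
    have LGG: "?R (L a) (G b) (G c)" for a b c
    proof (cases "a + b + c + 1 = 0")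
      case True
      then have c: "c = - a - b - 1" by simp
      show ?thesis unfolding c
        by (rule poly_mapping_eqI) (simp add: ext look field_simps)
    next
      case False
      then have "a + (b + c) + 1 \<noteq> 0" by simp
      then show ?thesis
        by (intro poly_mapping_eqI) (simp add: ext look algebra_simps)
    qed
    have GLG: "?R (G a) (L b) (G c)" for a b c
    proof (cases "a + b + c + 1 = 0")
      case True
      then have c: "c = - a - b - 1" by simp
      show ?thesis unfolding c
        by (rule poly_mapping_eqI) (simp add: ext look field_simps)
    next
      case False
      then have "a + (b + c) + 1 \<noteq> 0" by simp
      then show ?thesis
        by (intro poly_mapping_eqI) (simp add: ext look algebra_simps)
    qed
    have GGL: "?R (G a) (G b) (L c)" for a b c
    proof (cases "a + b + c + 1 = 0")
      case True
      then have c: "c = - a - b - 1" by simp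
      show ?thesis unfolding c
        by (rule poly_mapping_eqI) (simp add: ext look field_simps)
    next
      case False
      then have "a + (b + c) + 1 \<noteq> 0" by simp
      then show ?thesis
        by (intro poly_mapping_eqI) (simp add: ext look algebra_simps)
    qed
    show ?thesis
      by (cases i; cases j; cases k; hypsubst;
          (rule LLL LLW LWL WLL LLG LGL GLL LGG GLG GGL | (simp add: ext; fail)))
  qed
  have rel: "?A i (?A j v) - sbms_scale (koszul (gen_parity i) (gen_parity j)) (?A j (?A i v)) =
      lin_ext sbms_scale (\<lambda>g. ?A g v) (gen_bracket i j)" for i j v
  proof (rule sbms_ext_single[of sbms_scale _ _ v])
    show "Vector_Spaces.linear sbms_scale sbms_scale
        (\<lambda>v. ?A i (?A j v) - sbms_scale (koszul (gen_parity i) (gen_parity j)) (?A j (?A i v)))"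
      by (rule vs_linearI[OF vector_space_sbms vector_space_sbms])
         (simp_all add: ext_add ext_scale S.scale_right_distrib S.scale_right_diff_distrib mult.commute)
    show "Vector_Spaces.linear sbms_scale sbms_scale (\<lambda>v. lin_ext sbms_scale (\<lambda>g. ?A g v) (gen_bracket i j))"
      by (rule linear_lin_ext_arg[OF vector_space_sbms lin])
  next
    fix k
    show "?A i (?A j (Poly_Mapping.single k 1)) -
        sbms_scale (koszul (gen_parity i) (gen_parity j)) (?A j (?A i (Poly_Mapping.single k 1))) =
        lin_ext sbms_scale (\<lambda>g. ?A g (Poly_Mapping.single k 1)) (gen_bracket i j)"
      using rel_gen[of i j k] by (simp only: lin_ext_single[OF vector_space_sbms] neg1)
  qed
  have closed: "?A g v \<in> sbms_part (gen_parity g \<noteq> q)" if "v \<in> sbms_part q" for g q v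
    unfolding lin_ext_def
    by (rule S.subspace_sum[OF subspace_sbms_part], rule S.subspace_scale[OF subspace_sbms_part])
       (use that gen_bracket_parity[of g] in \<open>force simp: sbms_part_def\<close>)
  have "\<exists>a \<in> sbms_part False. \<exists>b \<in> sbms_part True. v = a + b" for v
  proof -
    define a where "a = lin_ext sbms_scale (\<lambda>g. if gen_parity g then 0 else Poly_Mapping.single g 1) v"
    define b where "b = lin_ext sbms_scale (\<lambda>g. if gen_parity g then Poly_Mapping.single g 1 else 0) v"
    have "v = lin_ext sbms_scale (\<lambda>g. Poly_Mapping.single g 1) v"
      unfolding lin_ext_def
      by (rule poly_mapping_eqI)
         (auto simp: lookup_sum lookup_single when_def in_keys_iff if_distrib sum.delta cong: if_cong)
    also have "\<dots> = a + b"
      unfolding a_def b_def lin_ext_def sum.distrib[symmetric]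
      by (intro sum.cong refl) simp
    finally have "v = a + b" .
    moreover have "a \<in> sbms_part False" "b \<in> sbms_part True"
      unfolding a_def b_def lin_ext_def
      by (rule S.subspace_sum[OF subspace_sbms_part];
          force simp: sbms_part_def split: if_splits)+
    ultimately show ?thesis by blast
  qed
  moreover have "sbms_part False \<inter> sbms_part True = {0}"
  proof -
    have "x = 0" if "x \<in> sbms_part False" "x \<in> sbms_part True" for x
      using that by (auto simp: sbms_part_def intro!: poly_mapping_eqI)
    then show ?thesis by (auto simp: sbms_part_def)
  qed
  ultimately have "is_supermodule \<lparr>scale = sbms_scale, part = sbms_part,
      act = (\<lambda>x v. lin_ext sbms_scale (\<lambda>g. ?A g v) x)\<rparr>"
    by (intro supermodule_lin_ext vector_space_sbms subspace_sbms_part lin rel closed)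
  then show ?thesis
    by (simp add: sbms_bracket_def[abs_def])
qed

lemma const2_simps:
  "const2 0 = 0" "const2 1 = 1" "const2 (a + b) = const2 a + const2 b"
  "const2 (a - b) = const2 a - const2 b" "const2 (- a) = - const2 a"
  "const2 (a * b) = const2 a * const2 b"
  by (simp_all add: const2_def one_pCons)

lemma in_t_simps:
  "in_t 0 = 0" "in_t 1 = 1" "in_t (p + q) = in_t p + in_t q" "in_t (p - q) = in_t p - in_t q"
  "in_t (p * q) = in_t p * in_t q" "in_t (smult c p) = const2 c * in_t p"
  "in_t [:c:] = const2 c"
  by (simp_all add: in_t_def const2_def one_pCons)

lemma shift_simps:
  "shift a (f + g) = shift a f + shift a g" "shift a (f - g) = shift a f - shift a g"
  "shift a (f * g) = shift a f * shift a g" "shift a (const2 c) = const2 c"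
  "shift a (in_t p) = in_t p" "shift a var_t = var_t" "shift a var_s = var_s - const2 a"
  "shift a 0 = 0"
  by (simp_all add: shift_def pcompose_add pcompose_diff pcompose_mult const2_def in_t_def
      var_t_def var_s_def pcompose_pCons)

lemma shift_shift: "shift a (shift b f) = shift (a + b) f"
proof -
  have "pcompose (var_s - const2 b) (var_s - const2 a) = var_s - const2 (a + b)"
    by (simp add: var_s_def const2_def pcompose_pCons)
  then show ?thesis by (simp add: shift_def pcompose_assoc[symmetric])
qed

lemma shift_numeral: "shift a (numeral w) = numeral w"
  by (simp add: shift_def numeral_poly)

lemma coeff_d_t: "coeff (d_t f) n = pderiv (coeff f n)"
  by (simp add: d_t_def coeff_map_poly)

lemma pderiv_sum': "pderiv (\<Sum>i\<in>A. f i) = (\<Sum>i\<in>A. pderiv (f i :: complex poly))"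
  by (induction A rule: infinite_finite_induct) (simp_all add: pderiv_add)

lemma d_t_add: "d_t (f + g) = d_t f + d_t g"
  and d_t_diff: "d_t (f - g) = d_t f - d_t g"
  and d_t_0: "d_t 0 = 0"
  by (simp_all add: poly_eq_iff coeff_d_t pderiv_add pderiv_diff)

lemma d_t_mult: "d_t (f * g) = d_t f * g + f * d_t g"
proof (rule poly_eqI)
  fix n
  have "coeff (d_t (f * g)) n =
      (\<Sum>i\<le>n. pderiv (coeff f i) * coeff g (n - i) + coeff f i * pderiv (coeff g (n - i)))"
    unfolding coeff_d_t coeff_mult pderiv_sum' pderiv_mult
    by (intro sum.cong refl) (simp add: mult.commute add.commute)
  then show "coeff (d_t (f * g)) n = coeff (d_t f * g + f * d_t g) n"
    by (simp add: coeff_d_t coeff_mult sum.distrib)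
qed

lemma d_t_in_t: "d_t (in_t p) = in_t (pderiv p)"
  by (rule poly_eqI) (simp add: coeff_d_t in_t_def coeff_pCons split: nat.split)

lemma d_t_base: "d_t (const2 c) = 0" "d_t var_t = 1" "d_t var_s = 0"
proof -
  show "d_t (const2 c) = 0"
    using d_t_in_t[of "[:c:]"] by (simp add: in_t_simps)
  show "d_t var_t = 1"
    by (simp add: var_t_def d_t_in_t pderiv_pCons in_t_simps const2_simps)
  show "d_t var_s = 0"
    by (rule poly_eqI) (simp add: coeff_d_t var_s_def coeff_pCons split: nat.split)
qed

lemmas d_t_simps = d_t_add d_t_diff d_t_0 d_t_mult d_t_in_t d_t_base

lemma d_t_shift: "d_t (shift a f) = shift a (d_t f)"
proof (induction f rule: pCons_induct)
  case 0
  then show ?case by (simp add: d_t_0 shift_simps)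
next
  case (pCons p f)
  have 1: "pCons q g = in_t q + var_s * g" for q g
    by (simp add: in_t_def var_s_def)
  show ?case using pCons.IH
    by (simp add: 1 shift_simps d_t_simps)
qed

lemma h_seq_decomp:
  obtains c q where
    "\<And>m. in_t (h_seq \<alpha> h m) =
       const2 (of_int m) * (const2 c + in_t q * (var_t - const2 (of_int m * \<alpha>)))"
proof -
  define q where "q = (h - [:poly h \<alpha>:]) div [:- \<alpha>, 1:]"
  define c where "c = poly h \<alpha>"
  have "[:- \<alpha>, 1:] dvd h - [:poly h \<alpha>:]" by (simp add: poly_eq_0_iff_dvd[symmetric])
  then have "h - [:c:] = [:- \<alpha>, 1:] * q" unfolding q_def c_def by (simp only: dvd_mult_div_cancel)
  then have "h = [:c:] + ([:0, 1:] - [:\<alpha>:]) * q" by (simp add: algebra_simps)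
  then have h: "in_t h = const2 c + (var_t - const2 \<alpha>) * in_t q"
    by (metis in_t_simps(3,4,5,7) var_t_def)
  have "in_t (h_seq \<alpha> h m) =
       const2 (of_int m) * (const2 c + in_t q * (var_t - const2 (of_int m * \<alpha>)))" for m
    unfolding h_seq_def q_def[symmetric]
    by (simp add: in_t_simps h const2_simps algebra_simps)
  then show ?thesis using that by blast
qed

lemma vector_space_pair: "vector_space pair_scale"
  by unfold_locales
     (auto simp: pair_scale_def scale2_def const2_simps prod_eq_iff algebra_simps)

lemma linear_omega_gen:
  "Vector_Spaces.linear pair_scale pair_scale (omega_gen lam \<alpha> h g)"
proof -
  interpret V: vector_space pair_scale by (rule vector_space_pair)
  show ?thesis
  proof (rule vs_linearI[OF vector_space_pair vector_space_pair])
    fix v w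
    show "omega_gen lam \<alpha> h g (v + w) = omega_gen lam \<alpha> h g v + omega_gen lam \<alpha> h g w"
      by (cases g; cases v; cases w)
         (simp_all add: scale2_def shift_simps d_t_simps zero_prod_def algebra_simps)
  next
    fix c v
    show "omega_gen lam \<alpha> h g (pair_scale c v) = pair_scale c (omega_gen lam \<alpha> h g v)"
      by (cases g; cases v)
         (simp_all add: pair_scale_def scale2_def shift_simps d_t_simps zero_prod_def algebra_simps)
  qed
qed

lemma d_t_numeral: "d_t (numeral w) = 0"
  using d_t_base(1)[of "numeral w"] by (simp add: const2_def numeral_poly)

lemma half_add: "half (m + k) = of_int m + half k" "half (k + m) = of_int m + half k"
  by (simp_all add: half_def)

lemma omega_rel:
  assumes lam: "lam \<noteq> 0"
  shows "omega_gen lam \<alpha> h i (omega_gen lam \<alpha> h j v) -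
     pair_scale (koszul (gen_parity i) (gen_parity j)) (omega_gen lam \<alpha> h j (omega_gen lam \<alpha> h i v)) =
     lin_ext pair_scale (\<lambda>g. omega_gen lam \<alpha> h g v) (gen_bracket i j)"
proof -
  interpret V: vector_space pair_scale by (rule vector_space_pair)
  interpret P: vector_space_pair sbms_scale pair_scale
    by (intro vector_space_pair.intro vector_space_sbms vector_space_pair)
  obtain f k where v: "v = (f, k)" by (cases v)
  have lin: "Vector_Spaces.linear sbms_scale pair_scale (lin_ext pair_scale F)" for F
    by (rule linear_lin_ext[OF vector_space_pair])
  have ext_add: "lin_ext pair_scale F (x + y) = lin_ext pair_scale F x + lin_ext pair_scale F y"
    and ext_diff: "lin_ext pair_scale F (x - y) = lin_ext pair_scale F x - lin_ext pair_scale F y"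
    and ext_neg: "lin_ext pair_scale F (- x) = - lin_ext pair_scale F x"
    and ext_0: "lin_ext pair_scale F 0 = 0" for F x y
    using lin P.linear_add P.linear_diff P.linear_neg P.linear_0 by blast+
  have ext_if: "lin_ext pair_scale F (if b then x else 0) = (if b then lin_ext pair_scale F x else 0)"
    for F b x by (simp add: ext_0)
  note ext = ext_add ext_diff ext_neg ext_0 ext_if lin_ext_single[OF vector_space_pair]
  obtain c q where hs: "in_t (h_seq \<alpha> h m) =
      const2 (of_int m) * (const2 c + in_t q * (var_t - const2 (of_int m * \<alpha>)))" for m
    using h_seq_decomp by blast
  have two: "const2 2 = 2" using const2_simps(3)[of 1 1] by (simp add: const2_simps)
  have half_m: "const2 (of_int m) = 2 * const2 (of_int m / 2)" for m
    using const2_simps(3)[of "of_int m / 2" "of_int m / 2"] by simp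
  have powi: "lam powi (m + n) = lam powi m * lam powi n" "lam powi 1 = lam" for m n
    using lam by (simp_all add: power_int_add)
  have half2: "2 * half k = of_int (2 * k + 1)" "half k + half l = of_int (k + l + 1)" for k l
    by (simp_all add: half_def)
  have om0: "omega_gen lam \<alpha> h g 0 = 0" for g
    by (cases g) (simp_all add: zero_prod_def scale2_def shift_simps d_t_simps)
  note rules = v d_t_numeral shift_numeral koszul_def ext pair_scale_def scale2_def hs shift_simps shift_shift d_t_simps
     d_t_shift const2_simps in_t_simps powi two
  have LL: ?thesis if "i = L m" "j = L n" for m n
    unfolding that by (simp add: rules add_divide_distrib algebra_simps, simp add: half_m mult_ac)
  have LW: ?thesis if "i = L m" "j = W n" for m n
    unfolding that by (simp add: rules zero_prod_def algebra_simps)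
  have WL: ?thesis if "i = W m" "j = L n" for m n
    unfolding that by (simp add: rules zero_prod_def algebra_simps)
  have WW: ?thesis if "i = W m" "j = W n" for m n
    unfolding that by (simp add: rules algebra_simps)
  have LG: ?thesis if "i = L m" "j = G n" for m n
    unfolding that by (simp add: rules half_m half_add[where m = m and k = n] algebra_simps)
  have GL: ?thesis if "i = G m" "j = L n" for m n
    unfolding that by (simp add: rules half_m half_add[where m = n and k = m] algebra_simps)
  have WG: ?thesis if "i = W m" "j = G n" for m n
    unfolding that by (simp add: rules algebra_simps)
  have GW: ?thesis if "i = G m" "j = W n" for m n
    unfolding that by (simp add: rules algebra_simps)
  have GG: ?thesis if "i = G m" "j = G n" for m n
  proof -
    have half_n: "const2 (half n) = const2 (of_int m) + const2 (of_int n) + 1 - const2 (half m)"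
      unfolding const2_simps(2-4)[symmetric] by (simp add: half_def)
    show ?thesis
      unfolding that by (simp add: rules half2 algebra_simps, simp add: half_n algebra_simps)
  qed
  show ?thesis
    using LL LW WL WW LG GL WG GW GG
    by (cases i; cases j) (simp_all add: rules om0, simp_all add: zero_prod_def)
qed

proposition is_supermodule_Omega:
  assumes "lam \<noteq> 0"
  shows "is_supermodule (Omega lam \<alpha> h)"
proof -
  interpret V: vector_space pair_scale by (rule vector_space_pair)
  define pt :: "bool \<Rightarrow> (poly2 \<times> poly2) set"
    where "pt = (\<lambda>p. if p then {v. fst v = 0} else {v. snd v = 0})"
  have "is_supermodule \<lparr>scale = pair_scale, part = pt,
          act = (\<lambda>x v. lin_ext pair_scale (\<lambda>g. omega_gen lam \<alpha> h g v) x)\<rparr>"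
  proof (rule supermodule_lin_ext[OF vector_space_pair _ _ _ linear_omega_gen _ omega_rel[OF assms]])
    show "V.subspace (pt p)" for p
      by (rule V.subspaceI) (auto simp: pt_def pair_scale_def scale2_def)
    show "pt False \<inter> pt True = {0}"
      by (auto simp: pt_def prod_eq_iff)
    show "\<exists>a \<in> pt False. \<exists>b \<in> pt True. v = a + b" for v
      by (rule bexI[of _ "(fst v, 0)"], rule bexI[of _ "(0, snd v)"]) (auto simp: pt_def prod_eq_iff)
    show "omega_gen lam \<alpha> h g v \<in> pt (gen_parity g \<noteq> q)" if "v \<in> pt q" for g q v
      using that
      by (cases g; cases v) (auto simp: pt_def scale2_def shift_simps d_t_simps split: if_splits)
  qed
  then show ?thesis by (simp add: Omega_def pt_def)
qed

proposition is_supermodule_Pi_change: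
  assumes "is_supermodule M"
  shows "is_supermodule (Pi_change M)"
proof -
  note M = assms[unfolded is_supermodule_def]
  note M1 = M[THEN conjunct1] and R1 = M[THEN conjunct2]
  note M2 = R1[THEN conjunct1] and R2 = R1[THEN conjunct2]
  note M3 = R2[THEN conjunct1] and R3 = R2[THEN conjunct2]
  note M4 = R3[THEN conjunct1] and R4 = R3[THEN conjunct2]
  note M5 = R4[THEN conjunct1] and R5 = R4[THEN conjunct2]
  note M6 = R5[THEN conjunct1] and R6 = R5[THEN conjunct2]
  note M7 = R6[THEN conjunct1] and M8 = R6[THEN conjunct2]
  have sel: "scale (Pi_change M) = scale M" "part (Pi_change M) p = part M (\<not> p)"
    "act (Pi_change M) = act M" for p
    by (simp_all add: Pi_change_def)
  have grade: "\<forall>p q. \<forall>x \<in> sbms_part p. \<forall>v \<in> part M (\<not> q). act M x v \<in> part M (\<not> (p \<noteq> q))"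
  proof (intro allI ballI)
    fix p q x v
    assume "x \<in> sbms_part p" "v \<in> part M (\<not> q)"
    then have "act M x v \<in> part M (p \<noteq> (\<not> q))"
      using M7[rule_format] by blast
    moreover have "(p \<noteq> (\<not> q)) = (\<not> (p \<noteq> q))" by blast
    ultimately show "act M x v \<in> part M (\<not> (p \<noteq> q))" by (simp only:)
  qed
  have dec: "\<forall>v. \<exists>a \<in> part M True. \<exists>b \<in> part M False. v = a + b"
    
  proof
    fix v
    obtain a b where "a \<in> part M False" "b \<in> part M True" "v = a + b"
      using M4 by blast
    then show "\<exists>a \<in> part M True. \<exists>b \<in> part M False. v = a + b"
      by (intro bexI[of _ b] bexI[of _ a]) (simp_all add: add.commute)
  qed
  have int: "part M True \<inter> part M False = {0}"
    using M3 by (simp add: Int_commute)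
  have sub: "\<forall>p. module.subspace (scale M) (part M (\<not> p))"
    using M2 by simp
  show ?thesis
    unfolding is_supermodule_def sel not_False_eq_True not_True_eq_False
    by (intro conjI grade dec int sub M1 M5 M6 M8)
qed

end

theory Submission
  imports Defs
begin

text \<open>
  On \<open>\<Omega>(\<lambda>, \<alpha>, h)\<close> the generators \<open>W\<^sub>0\<close> and \<open>L\<^sub>0\<close> act as multiplication by the two variables. A
  homomorphism \<open>\<phi>\<close> between two such modules, of either parity, is therefore \<open>\<complex>[t,s]\<close>-linear and is
  determined by \<open>\<phi>(1, 0)\<close> and \<open>\<phi>(0, 1)\<close>. If \<open>\<phi>\<close> is homogeneous and surjective, the nonzero components
  \<open>u\<close> and \<open>w\<close> of these two vectors divide \<open>1\<close>, so they are nonzero constants.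

  An even isomorphism is thus multiplication by a constant on the even part. Comparing the images of
  \<open>W\<^sub>1(1, 0)\<close> gives \<open>\<lambda>(t - \<alpha>) = \<mu>(t - \<beta>)\<close>, hence equality of the first two parameters; comparing
  the images of \<open>L\<^sub>1(1, 0)\<close> gives \<open>\<lambda>(s + h) = \<mu>(s + g)\<close>, because \<open>h\<^sub>1 = h\<close>.

  The parity change is excluded by the asymmetry of the odd generators: \<open>G\<^bsub>1/2\<^esub>\<close> maps
  \<open>\<complex>[t,s]\<close> bijectively onto \<open>\<complex>[y,x]\<close>, while in the other direction its image lies in the proper
  ideal generated by \<open>t - \<alpha>\<close>. An isomorphism from the parity-changed module would turn the equation
  \<open>G\<^bsub>1/2\<^esub>(1, 0) = (0, 1)\<close> into \<open>u = \<lambda>'(t - \<alpha>')w\<close> with constants \<open>u, w \<noteq> 0\<close>, which is impossible.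
\<close>

lemma act_Omega_single:
  "act (Omega lam \<alpha> h) (Poly_Mapping.single x 1) v = omega_gen lam \<alpha> h x v"
  by (simp add: Omega_def lin_ext_single[OF vector_space_pair] pair_scale_def scale2_def const2_simps)

lemma omega_gen_L_0: "omega_gen lam \<alpha> h (L 0) v = (var_s * fst v, var_s * snd v)"
  by (cases v) (simp add: scale2_def const2_simps shift_def h_seq_def in_t_simps
      var_s_def)

lemma omega_gen_W_0: "omega_gen lam \<alpha> h (W 0) v = (var_t * fst v, var_t * snd v)"
  by (cases v) (simp add: scale2_def const2_simps shift_def var_s_def)

lemma shift_1 [simp]: "shift a 1 = 1"
  using shift_simps(4)[of a 1] by (simp add: const2_simps)

lemma d_t_1 [simp]: "d_t 1 = 0"
  using d_t_base(1)[of 1] by (simp add: const2_simps)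

text \<open>The two variables generate \<open>\<complex>[t,s]\<close> as an algebra, so Horner's scheme, once in \<open>s\<close> and once in
  \<open>t\<close> for each coefficient, reduces \<open>\<complex>[t,s]\<close>-linearity to multiplication by the variables.\<close>

lemma poly2_linearI:
  fixes \<phi> :: "poly2 \<times> poly2 \<Rightarrow> poly2 \<times> poly2"
  assumes add: "\<And>v w. \<phi> (v + w) = \<phi> v + \<phi> w"
    and scale: "\<And>c v. \<phi> (pair_scale c v) = pair_scale c (\<phi> v)"
    and t: "\<And>f k. \<phi> (var_t * f, var_t * k) = (var_t * fst (\<phi> (f, k)), var_t * snd (\<phi> (f, k)))"
    and s: "\<And>f k. \<phi> (var_s * f, var_s * k) = (var_s * fst (\<phi> (f, k)), var_s * snd (\<phi> (f, k)))"
  shows "\<phi> (q * f, q * k) = (q * fst (\<phi> (f, k)), q * snd (\<phi> (f, k)))"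
proof -
  have \<phi>_0: "\<phi> (0, 0) = (0, 0)"
    using add[of "(0, 0)" "(0, 0)"] by (simp add: zero_prod_def)
  have const: "\<phi> (const2 c * f, const2 c * k) = (const2 c * fst (\<phi> (f, k)), const2 c * snd (\<phi> (f, k)))"
    for c f k
    using scale[of c "(f, k)"] by (simp add: pair_scale_def scale2_def)
  have sum: "\<phi> ((a + b) * f, (a + b) * k) =
      ((a + b) * fst (\<phi> (f, k)), (a + b) * snd (\<phi> (f, k)))"
    if "\<phi> (a * f, a * k) = (a * fst (\<phi> (f, k)), a * snd (\<phi> (f, k)))"
      and "\<phi> (b * f, b * k) = (b * fst (\<phi> (f, k)), b * snd (\<phi> (f, k)))" for a b f k
    using add[of "(a * f, a * k)" "(b * f, b * k)"] that by (simp add: distrib_right)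
  have poly_t: "\<phi> (in_t p * f, in_t p * k) = (in_t p * fst (\<phi> (f, k)), in_t p * snd (\<phi> (f, k)))"
    for p f k
  proof (induction p rule: pCons_induct)
    case 0
    then show ?case by (simp add: in_t_simps \<phi>_0)
  next
    case (pCons c p)
    have "in_t (pCons c p) = const2 c + var_t * in_t p"
      by (simp add: in_t_def const2_def var_t_def)
    then show ?case
      by (simp only:) (rule sum[OF const], simp add: mult.assoc t pCons.IH)
  qed
  show ?thesis
  proof (induction q rule: pCons_induct)
    case 0
    then show ?case by (simp add: \<phi>_0)
  next
    case (pCons p q)
    have "pCons p q = in_t p + var_s * q"
      by (simp add: in_t_def var_s_def)
    then show ?case
      by (simp only:) (rule sum[OF poly_t], simp add: mult.assoc s pCons.IH)
  qed
qed

text \<open>Since \<open>L\<^sub>0\<close> and \<open>W\<^sub>0\<close> act as multiplication by the variables, homomorphisms are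
  \<open>\<complex>[t,s]\<close>-linear, and the underlying space is free over \<open>\<complex>[t,s]\<close> with basis \<open>(1, 0)\<close>, \<open>(0, 1)\<close>.
  The formula covers maps of both parities.\<close>

lemma Omega_hom_eq:
  assumes lin: "Vector_Spaces.linear pair_scale pair_scale \<phi>"
    and gen: "\<And>x v. \<phi> (omega_gen lam \<alpha> h x v) = omega_gen \<mu> \<beta> g x (\<phi> v)"
  shows "\<phi> (f, k) = (f * fst (\<phi> (1, 0)) + k * fst (\<phi> (0, 1)),
                     f * snd (\<phi> (1, 0)) + k * snd (\<phi> (0, 1)))"
proof -
  have add: "\<phi> (v + w) = \<phi> v + \<phi> w" and scale: "\<phi> (pair_scale c v) = pair_scale c (\<phi> v)" for c v w
    using lin unfolding Vector_Spaces.linear_iff by blast+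
  have var: "\<phi> (var_s * f, var_s * k) = (var_s * fst (\<phi> (f, k)), var_s * snd (\<phi> (f, k)))"
    "\<phi> (var_t * f, var_t * k) = (var_t * fst (\<phi> (f, k)), var_t * snd (\<phi> (f, k)))" for f k
    using gen[of "L 0" "(f, k)"] gen[of "W 0" "(f, k)"]
    unfolding omega_gen_L_0 omega_gen_W_0 by simp_all
  note poly = poly2_linearI[OF add scale var(2) var(1)]
  show ?thesis
    using add[of "(f, 0)" "(0, k)"] poly[of f 1 0] poly[of k 0 1] by simp
qed

lemma poly2_unit_const:
  fixes u :: poly2
  assumes "f * u = 1"
  shows "\<exists>c. u = const2 c \<and> c \<noteq> 0"
proof -
  have "u dvd 1" using assms by (metis dvd_triv_right)
  then obtain p where p: "u = [:p:]" "p dvd 1" by (auto simp: is_unit_poly_iff)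
  then obtain c where "p = [:c:]" "c dvd 1" using is_unit_poly_iff[of p] by blast
  with p show ?thesis by (auto simp: const2_def)
qed

text \<open>Here \<open>M\<close> may differ from \<open>\<Omega>(\<lambda>, \<alpha>, h)\<close> in its grading only; this treats the module and its
  parity change alike.\<close>

lemma supermodule_iso_OmegaE:
  assumes "M \<cong>\<^sub>s Omega \<mu> \<beta> g" "scale M = pair_scale" "act M = act (Omega lam \<alpha> h)"
  obtains \<phi> where
    "\<And>p v. v \<in> part M p \<Longrightarrow> \<phi> v \<in> part (Omega \<mu> \<beta> g) p"
    "\<And>x v. \<phi> (omega_gen lam \<alpha> h x v) = omega_gen \<mu> \<beta> g x (\<phi> v)"
    "surj \<phi>"
    "\<And>f k. \<phi> (f, k) = (f * fst (\<phi> (1, 0)) + k * fst (\<phi> (0, 1)),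
                       f * snd (\<phi> (1, 0)) + k * snd (\<phi> (0, 1)))"
proof -
  obtain \<phi> where lin: "Vector_Spaces.linear pair_scale pair_scale \<phi>" and "bij \<phi>"
    and par: "\<And>p. \<phi> ` part M p \<subseteq> part (Omega \<mu> \<beta> g) p"
    and act: "\<And>x v. \<phi> (act M x v) = act (Omega \<mu> \<beta> g) x (\<phi> v)"
    using assms(1,2) unfolding supermodule_iso_def by (auto simp: Omega_def)
  have gen: "\<phi> (omega_gen lam \<alpha> h x v) = omega_gen \<mu> \<beta> g x (\<phi> v)" for x v
    using act[of "Poly_Mapping.single x 1" v] by (simp add: assms(3) act_Omega_single)
  show ?thesis
  proof (rule that[of \<phi>])
    show "\<phi> v \<in> part (Omega \<mu> \<beta> g) p" if "v \<in> part M p" for p v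
      using par that by blast
  qed (fact gen bij_is_surj[OF \<open>bij \<phi>\<close>] Omega_hom_eq[OF lin gen])+
qed

text \<open>On the constant \<open>1\<close>, \<open>G\<^bsub>1/2\<^esub>\<close> acts as \<open>1\<close> from the even to the odd part and as
  \<open>\<lambda>(t - \<alpha>)\<close> back, which is not constant. After a parity change the two roles are interchanged.\<close>

lemma Pi_Omega_not_iso_Omega:
  assumes "lam' \<noteq> 0"
  shows "\<not> (Pi_change (Omega lam \<alpha> h) \<cong>\<^sub>s Omega lam' \<alpha>' h')"
proof
  assume "Pi_change (Omega lam \<alpha> h) \<cong>\<^sub>s Omega lam' \<alpha>' h'"
  then obtain \<phi> where
    par: "\<And>p v. v \<in> part (Pi_change (Omega lam \<alpha> h)) p \<Longrightarrow> \<phi> v \<in> part (Omega lam' \<alpha>' h') p"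
    and gen: "\<And>x v. \<phi> (omega_gen lam \<alpha> h x v) = omega_gen lam' \<alpha>' h' x (\<phi> v)"
    and surj: "surj \<phi>"
    and hom: "\<And>f k. \<phi> (f, k) = (f * fst (\<phi> (1, 0)) + k * fst (\<phi> (0, 1)),
                                  f * snd (\<phi> (1, 0)) + k * snd (\<phi> (0, 1)))"
    by (rule supermodule_iso_OmegaE[where lam = lam and \<alpha> = \<alpha> and h = h])
      (simp add: Pi_change_def Omega_def, simp add: Pi_change_def, rule that)
  define u w where "u = fst (\<phi> (0, 1))" and "w = snd (\<phi> (1, 0))"
  have "fst (\<phi> (1, 0)) = 0" "snd (\<phi> (0, 1)) = 0"
    using par[of "(1, 0)" True] par[of "(0, 1)" False] by (simp_all add: Pi_change_def Omega_def)
  then have \<phi>: "\<phi> (f, k) = (k * u, f * w)" for f k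
    using hom[of f k] by (simp add: u_def w_def)
  obtain f k where "\<phi> (f, k) = (1, 1)"
    using surj by (metis surjD prod.exhaust)
  then obtain c d where u: "u = const2 c" "c \<noteq> 0" and w: "w = const2 d" "d \<noteq> 0"
    using poly2_unit_const[of k u] poly2_unit_const[of f w] \<phi> by auto
  have "const2 c = scale2 lam' ((var_t - const2 \<alpha>') * const2 d)"
    using gen[of "G 0" "(1, 0)"]
    by (simp add: \<phi> u w scale2_def const2_simps half_def shift_simps)
  then have "lam' * d = 0"
    by (simp add: scale2_def const2_def var_t_def in_t_def)
  with assms w show False by simp
qed

text \<open>On the constant \<open>1\<close>, the generators \<open>W\<^sub>1\<close> and \<open>L\<^sub>1\<close> act as \<open>\<lambda>(t - \<alpha>)\<close> and \<open>\<lambda>(s + h)\<close>. These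
  polynomials determine the parameters and are not changed by rescaling \<open>1\<close>.\<close>

lemma Omega_iso_parameters_eq:
  assumes iso: "Omega lam \<alpha> h \<cong>\<^sub>s Omega \<mu> \<beta> g" and "lam \<noteq> 0"
  shows "lam = \<mu>" and "\<alpha> = \<beta>" and "h = g"
proof -
  from iso obtain \<phi> where
    par: "\<And>p v. v \<in> part (Omega lam \<alpha> h) p \<Longrightarrow> \<phi> v \<in> part (Omega \<mu> \<beta> g) p"
    and gen: "\<And>x v. \<phi> (omega_gen lam \<alpha> h x v) = omega_gen \<mu> \<beta> g x (\<phi> v)"
    and surj: "surj \<phi>"
    and hom: "\<And>f k. \<phi> (f, k) = (f * fst (\<phi> (1, 0)) + k * fst (\<phi> (0, 1)),
                                  f * snd (\<phi> (1, 0)) + k * snd (\<phi> (0, 1)))"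
    by (rule supermodule_iso_OmegaE[where lam = lam and \<alpha> = \<alpha> and h = h])
      (simp add: Omega_def, rule refl, rule that)
  define u w where "u = fst (\<phi> (1, 0))" and "w = snd (\<phi> (0, 1))"
  have "snd (\<phi> (1, 0)) = 0" "fst (\<phi> (0, 1)) = 0"
    using par[of "(1, 0)" False] par[of "(0, 1)" True] by (simp_all add: Omega_def)
  then have \<phi>: "\<phi> (f, k) = (f * u, k * w)" for f k
    using hom[of f k] by (simp add: u_def w_def)
  obtain f k where "\<phi> (f, k) = (1, 1)"
    using surj by (metis surjD prod.exhaust)
  then obtain c where u: "u = const2 c" "c \<noteq> 0"
    using poly2_unit_const[of f u] \<phi> by auto
  have "scale2 lam (var_t - const2 \<alpha>) * const2 c = scale2 \<mu> ((var_t - const2 \<beta>) * const2 c)"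
    using gen[of "W 1" "(1, 0)"] by (simp add: \<phi> u scale2_def shift_simps)
  then have W: "lam * c = \<mu> * c" "lam * \<alpha> * c = \<mu> * \<beta> * c"
    by (simp_all add: scale2_def const2_def var_t_def in_t_def)
  with u assms show lam: "lam = \<mu>" and "\<alpha> = \<beta>" by auto
  have "scale2 lam (var_s + in_t h) * const2 c = scale2 \<mu> ((var_s + in_t g) * const2 c)"
    using gen[of "L 1" "(1, 0)"]
    by (simp add: \<phi> u scale2_def shift_simps d_t_simps h_seq_def)
  then have "smult (\<mu> * c) h = smult (\<mu> * c) g"
    by (simp add: lam scale2_def const2_def var_s_def in_t_def mult.commute)
  then show "h = g"
    using u assms lam by (simp add: poly_eq_iff)
qed

lemma supermodule_iso_refl:
  assumes "vector_space (scale M)"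
  shows "M \<cong>\<^sub>s M"
  unfolding supermodule_iso_def
  by (rule exI[of _ "\<lambda>v. v"]) (auto intro: vs_linearI[OF assms assms] simp: bij_betw_def)

theorem theorem2p12:
  fixes lam \<mu> \<alpha> \<beta> :: complex and h g :: "complex poly"
  assumes "lam \<noteq> 0" and "\<mu> \<noteq> 0"
  shows "(\<forall>lam' \<alpha>' h'. lam' \<noteq> 0 \<longrightarrow> \<not> (Pi_change (Omega lam \<alpha> h) \<cong>\<^sub>s Omega lam' \<alpha>' h')) \<and>
         (Omega lam \<alpha> h \<cong>\<^sub>s Omega \<mu> \<beta> g \<longleftrightarrow> lam = \<mu> \<and> \<alpha> = \<beta> \<and> h = g)"
proof -
  have "Omega lam \<alpha> h \<cong>\<^sub>s Omega lam \<alpha> h"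
    by (rule supermodule_iso_refl) (simp add: Omega_def vector_space_pair)
  then show ?thesis
    using Pi_Omega_not_iso_Omega Omega_iso_parameters_eq[of lam \<alpha> h \<mu> \<beta> g] assms(1) by blast
qed

end
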